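(* Suppose that $(X,R)$ is a Yang–Baxter set with invertible $R:X\times X\to X\times X$. Then there is a representation $$\varphi_n^{R}: VP_n\to \mathrm{Sym}(X^{n}),\quad\text{for any } n\ge 2.$$
   Context: A Yang–Baxter set is a pair $(X,R)$ with $X$ a non-empty set and $R:X\times X\to X\times X$ a map satisfying the Yang–Baxter equation $R_{12}R_{13}R_{23}=R_{23}R_{13}R_{12}$ on $X^3$, where $R_{ij}:X^3\to X^3$ acts as $R$ on the $i$-th and $j$-th factors and as the identity on the remaining factor. Products are compositions of maps, and $\mathrm{Sym}(X^n)$ is the group of bijections of $X^n$ onto itself. A representation here means a group homomorphism. The virtual pure braid group $VP_n$, $n\ge 2$, is the group with generators $\lambda_{ij}$, $1\le i\ne j\le n$, and defining relations $$\lambda_{ij}\lambda_{kl}=\lambda_{kl}\lambda_{ij},\qquad \lambda_{ki}\lambda_{kj}\lambda_{ij}=\lambda_{ij}\lambda_{kj}\lambda_{ki},$$ where distinct letters stand for distinct indices. *)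

theory Defs
  imports "HOL-Algebra.Bij"
begin

section \<open>Groups given by generators and relations\<close>

text \<open>A word is a list of letters; the letter \<open>(g, True)\<close> stands for the generator \<open>g\<close>
  and \<open>(g, False)\<close> for its formal inverse.  A relation \<open>u = v\<close> is a pair of words.\<close>

type_synonym 'g word = "('g \<times> bool) list"

definition words :: "'g set \<Rightarrow> 'g word set" where
  "words S = lists (S \<times> UNIV)"

inductive word_eq :: "'g set \<Rightarrow> ('g word \<times> 'g word) set \<Rightarrow> 'g word \<Rightarrow> 'g word \<Rightarrow> bool"
  for S Rel where
  refl: "w \<in> words S \<Longrightarrow> word_eq S Rel w w"
| sym: "word_eq S Rel u v \<Longrightarrow> word_eq S Rel v u"
| trans: "word_eq S Rel u v \<Longrightarrow> word_eq S Rel v w \<Longrightarrow> word_eq S Rel u w"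
| append: "word_eq S Rel u u' \<Longrightarrow> word_eq S Rel v v' \<Longrightarrow> word_eq S Rel (u @ v) (u' @ v')"
| cancel: "g \<in> S \<Longrightarrow> word_eq S Rel [(g, b), (g, \<not> b)] []"
| rel: "(u, v) \<in> Rel \<Longrightarrow> u \<in> words S \<Longrightarrow> v \<in> words S \<Longrightarrow> word_eq S Rel u v"

definition word_class :: "'g set \<Rightarrow> ('g word \<times> 'g word) set \<Rightarrow> 'g word \<Rightarrow> 'g word set" where
  "word_class S Rel w = {v. word_eq S Rel w v}"

definition presented_group :: "'g set \<Rightarrow> ('g word \<times> 'g word) set \<Rightarrow> 'g word set monoid" where
  "presented_group S Rel =
    \<lparr>carrier = word_class S Rel ` words S,
     mult = \<lambda>A B. {w. \<exists>u\<in>A. \<exists>v\<in>B. word_eq S Rel (u @ v) w},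
     one = word_class S Rel []\<rparr>"

lemma words_append [simp]: "u @ v \<in> words S \<longleftrightarrow> u \<in> words S \<and> v \<in> words S"
  by (auto simp: words_def)

lemma words_Nil [simp]: "[] \<in> words S"
  by (simp add: words_def)

lemma word_eq_words: "word_eq S Rel u v \<Longrightarrow> u \<in> words S \<and> v \<in> words S"
  by (induction rule: word_eq.induct) (auto simp: words_def)

lemma word_class_eq_iff:
  assumes "u \<in> words S"
  shows "word_class S Rel u = word_class S Rel v \<longleftrightarrow> word_eq S Rel u v"
  using assms unfolding word_class_def
  by (auto intro: word_eq.refl word_eq.sym word_eq.trans)

lemma presented_group_mult:
  assumes "u \<in> words S" "v \<in> words S"
  shows "word_class S Rel u \<otimes>\<^bsub>presented_group S Rel\<^esub> word_class S Rel v
    = word_class S Rel (u @ v)"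
  using assms unfolding word_class_def presented_group_def
  by (auto intro: word_eq.refl word_eq.trans word_eq.append)

definition inv_word :: "'g word \<Rightarrow> 'g word" where
  "inv_word w = rev (map (\<lambda>(g, b). (g, \<not> b)) w)"

lemma inv_word_words [simp]: "w \<in> words S \<Longrightarrow> inv_word w \<in> words S"
  by (auto simp: words_def inv_word_def)

lemma word_eq_inv_word:
  assumes "w \<in> words S"
  shows "word_eq S Rel (inv_word w @ w) []"
  using assms
proof (induction w)
  case Nil
  then show ?case by (simp add: inv_word_def word_eq.refl)
next
  case (Cons a w)
  obtain g b where a: "a = (g, b)" by (cases a)
  have g: "g \<in> S" and w: "w \<in> words S"
    using Cons.prems by (auto simp: words_def a)
  have "word_eq S Rel [(g, \<not> b), (g, b)] []"
    using word_eq.cancel[OF g, of Rel "\<not> b"] by simp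
  from word_eq.append[OF this word_eq.refl[OF w]]
  have "word_eq S Rel ([(g, \<not> b), (g, b)] @ w) w" by simp
  from word_eq.append[OF word_eq.refl[OF inv_word_words[OF w]] this]
  have "word_eq S Rel (inv_word w @ ([(g, \<not> b), (g, b)] @ w)) (inv_word w @ w)" .
  then show ?case
    using Cons.IH[OF w] by (auto simp: a inv_word_def intro: word_eq.trans)
qed

theorem group_presented_group: "group (presented_group S Rel)"
proof (rule groupI)
  let ?G = "presented_group S Rel"
  have car: "carrier ?G = word_class S Rel ` words S"
    and one: "\<one>\<^bsub>?G\<^esub> = word_class S Rel []"
    by (simp_all add: presented_group_def)
  show "x \<otimes>\<^bsub>?G\<^esub> y \<in> carrier ?G" if "x \<in> carrier ?G" "y \<in> carrier ?G" for x y
    using that unfolding car by (auto simp: presented_group_mult)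
  show "\<one>\<^bsub>?G\<^esub> \<in> carrier ?G"
    by (simp add: car one)
  show "x \<otimes>\<^bsub>?G\<^esub> y \<otimes>\<^bsub>?G\<^esub> z = x \<otimes>\<^bsub>?G\<^esub> (y \<otimes>\<^bsub>?G\<^esub> z)"
    if "x \<in> carrier ?G" "y \<in> carrier ?G" "z \<in> carrier ?G" for x y z
    using that unfolding car by (auto simp: presented_group_mult)
  show "\<one>\<^bsub>?G\<^esub> \<otimes>\<^bsub>?G\<^esub> x = x" if "x \<in> carrier ?G" for x
    using that unfolding car one by (auto simp: presented_group_mult)
  show "\<exists>y\<in>carrier ?G. y \<otimes>\<^bsub>?G\<^esub> x = \<one>\<^bsub>?G\<^esub>" if x: "x \<in> carrier ?G" for x
  proof -
    obtain w where w: "w \<in> words S" "x = word_class S Rel w"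
      using x unfolding car by blast
    have "word_class S Rel (inv_word w) \<otimes>\<^bsub>?G\<^esub> x = \<one>\<^bsub>?G\<^esub>"
      using w by (simp add: presented_group_mult one word_class_eq_iff word_eq_inv_word)
    then show ?thesis using w unfolding car by auto
  qed
qed

section \<open>The virtual pure braid group\<close>

definition vp_gens :: "nat \<Rightarrow> (nat \<times> nat) set" where
  "vp_gens n = {(i, j). i \<in> {1..n} \<and> j \<in> {1..n} \<and> i \<noteq> j}"

abbreviation gen :: "nat \<Rightarrow> nat \<Rightarrow> (nat \<times> nat) \<times> bool" where
  "gen i j \<equiv> ((i, j), True)"

definition vp_rels :: "nat \<Rightarrow> ((nat \<times> nat) word \<times> (nat \<times> nat) word) set" where
  "vp_rels n =
     {([gen i j, gen k l], [gen k l, gen i j]) | i j k l.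
        {i, j, k, l} \<subseteq> {1..n} \<and> distinct [i, j, k, l]}
   \<union> {([gen k i, gen k j, gen i j], [gen i j, gen k j, gen k i]) | i j k.
        {i, j, k} \<subseteq> {1..n} \<and> distinct [i, j, k]}"

definition VP :: "nat \<Rightarrow> (nat \<times> nat) word set monoid" where
  "VP n = presented_group (vp_gens n) (vp_rels n)"

definition vp_gen :: "nat \<Rightarrow> nat \<Rightarrow> nat \<Rightarrow> (nat \<times> nat) word set" where
  "vp_gen n i j = word_class (vp_gens n) (vp_rels n) [gen i j]"

section \<open>Yang--Baxter sets\<close>

text \<open>Points of \<open>X\<^sup>n\<close> are extensional functions on \<open>{1..n}\<close>, so that \<open>Sym(X\<^sup>n)\<close> is
  \<open>BijGroup (cart_pow X n)\<close>, with composition of maps as product.\<close>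

definition cart_pow :: "'a set \<Rightarrow> nat \<Rightarrow> (nat \<Rightarrow> 'a) set" where
  "cart_pow X n = {1..n} \<rightarrow>\<^sub>E X"

text \<open>The map \<open>R\<^sub>i\<^sub>j\<close> on \<open>X\<^sup>n\<close>.  The pair of indices is ordered: the \<open>i\<close>-th entry is the
  first argument of \<open>R\<close>, also when \<open>i > j\<close>.\<close>

definition R_at ::
  "'a set \<Rightarrow> ('a \<times> 'a \<Rightarrow> 'a \<times> 'a) \<Rightarrow> nat \<Rightarrow> nat \<Rightarrow> nat \<Rightarrow> (nat \<Rightarrow> 'a) \<Rightarrow> nat \<Rightarrow> 'a" where
  "R_at X R n i j =
     (\<lambda>x \<in> cart_pow X n. x(i := fst (R (x i, x j)), j := snd (R (x i, x j))))"

definition yang_baxter_set :: "'a set \<Rightarrow> ('a \<times> 'a \<Rightarrow> 'a \<times> 'a) \<Rightarrow> bool" where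
  "yang_baxter_set X R \<longleftrightarrow>
     X \<noteq> {} \<and> R \<in> X \<times> X \<rightarrow> X \<times> X \<and>
     (\<forall>x \<in> cart_pow X 3.
        (R_at X R 3 1 2 \<circ> R_at X R 3 1 3 \<circ> R_at X R 3 2 3) x =
        (R_at X R 3 2 3 \<circ> R_at X R 3 1 3 \<circ> R_at X R 3 1 2) x)"

end

theory Submission
  imports Defs
begin

text \<open>A homomorphism out of a group given by generators and relations is the same thing as an
  assignment of group elements to the generators that satisfies the relations
  (\<open>presented_group_universal\<close>).  The proposition is this principle applied to
  \<open>\<lambda>\<^sub>i\<^sub>j \<mapsto> R\<^sub>i\<^sub>j\<close>, and so there are three things to check.

  Every \<open>R\<^sub>i\<^sub>j\<close> is a permutation of \<open>X\<^sup>n\<close>, its inverse being \<open>(R\<inverse>)\<^sub>i\<^sub>j\<close>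
  (\<open>R_at_Bij\<close>).  Maps acting on disjoint pairs of coordinates commute (\<open>R_at_commute\<close>).
  The remaining relation \<open>\<lambda>\<^sub>k\<^sub>i \<lambda>\<^sub>k\<^sub>j \<lambda>\<^sub>i\<^sub>j = \<lambda>\<^sub>i\<^sub>j \<lambda>\<^sub>k\<^sub>j \<lambda>\<^sub>k\<^sub>i\<close> is the Yang--Baxter equation read
  on the coordinates \<open>k, i, j\<close> in the place of \<open>1, 2, 3\<close>: the projection of \<open>X\<^sup>n\<close> to these
  three coordinates intertwines the maps on \<open>X\<^sup>n\<close> with those on \<open>X\<^sup>3\<close> (\<open>R_at_reindex\<close>), and
  all other coordinates stay fixed.  The indices \<open>k, i, j\<close> can occur in any order, and this is
  why \<open>R\<^sub>i\<^sub>j\<close> has to treat its indices as an ordered pair.\<close>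

section \<open>Homomorphisms out of a presented group\<close>

definition word_eval :: "('b, 'm) monoid_scheme \<Rightarrow> ('g \<Rightarrow> 'b) \<Rightarrow> 'g word \<Rightarrow> 'b" where
  "word_eval G f w =
     foldr (\<lambda>(g, b) y. (if b then f g else inv\<^bsub>G\<^esub> (f g)) \<otimes>\<^bsub>G\<^esub> y) w \<one>\<^bsub>G\<^esub>"

lemma word_eval_Nil [simp]: "word_eval G f [] = \<one>\<^bsub>G\<^esub>"
  by (simp add: word_eval_def)

lemma word_eval_Cons [simp]:
  "word_eval G f ((g, b) # w) =
     (if b then f g else inv\<^bsub>G\<^esub> (f g)) \<otimes>\<^bsub>G\<^esub> word_eval G f w"
  by (simp add: word_eval_def)

lemma (in group) word_eval_closed:
  assumes "f \<in> S \<rightarrow> carrier G" and "w \<in> words S"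
  shows "word_eval G f w \<in> carrier G"
  using assms(2)
proof (induction w)
  case (Cons a w)
  then show ?case using assms(1) by (cases a) (auto simp: words_def Pi_def)
qed simp

lemma (in group) word_eval_append:
  assumes "f \<in> S \<rightarrow> carrier G" and "u \<in> words S" and "v \<in> words S"
  shows "word_eval G f (u @ v) = word_eval G f u \<otimes> word_eval G f v"
  using assms(2)
proof (induction u)
  case Nil
  show ?case using word_eval_closed[OF assms(1,3)] by simp
next
  case (Cons a u)
  obtain g b where a: "a = (g, b)" by (cases a)
  have g: "f g \<in> carrier G" and u: "u \<in> words S"
    using Cons.prems assms(1) by (auto simp: words_def a)
  show ?case
    using Cons.IH[OF u] g word_eval_closed[OF assms(1) u] word_eval_closed[OF assms(1,3)]
    by (simp add: a m_assoc)
qed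

lemma (in group) word_eval_respects_word_eq:
  assumes f: "f \<in> S \<rightarrow> carrier G"
    and rels: "\<And>u v. (u, v) \<in> Rel \<Longrightarrow> word_eval G f u = word_eval G f v"
    and "word_eq S Rel u v"
  shows "word_eval G f u = word_eval G f v"
  using assms(3)
proof (induction rule: word_eq.induct)
  case (append u u' v v')
  then show ?case
    using word_eq_words[OF append.hyps(1)] word_eq_words[OF append.hyps(2)]
    by (simp add: word_eval_append[OF f])
next
  case (cancel g b)
  then have "f g \<in> carrier G" using f by auto
  then show ?case by simp
qed (simp_all add: rels)

text \<open>Von Dyck's theorem.  Word evaluation is constant on classes, so that evaluating any
  representative gives a well-defined map, which is multiplicative because the product of
  classes is concatenation.\<close>

theorem (in group) presented_group_universal:
  assumes f: "f \<in> S \<rightarrow> carrier G"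
    and rels: "\<And>u v. (u, v) \<in> Rel \<Longrightarrow> word_eval G f u = word_eval G f v"
  obtains \<phi> where "\<phi> \<in> hom (presented_group S Rel) G"
    and "\<And>g. g \<in> S \<Longrightarrow> \<phi> (word_class S Rel [(g, True)]) = f g"
proof -
  define \<phi> where "\<phi> A = word_eval G f (SOME w. w \<in> A)" for A
  have \<phi>: "\<phi> (word_class S Rel w) = word_eval G f w" if "w \<in> words S" for w
  proof -
    have "w \<in> word_class S Rel w"
      using that by (simp add: word_class_def word_eq.refl)
    then have "(SOME v. v \<in> word_class S Rel w) \<in> word_class S Rel w"
      by (rule someI)
    then have "word_eq S Rel w (SOME v. v \<in> word_class S Rel w)"
      by (simp add: word_class_def)
    from word_eval_respects_word_eq[OF f rels this] show ?thesis
      by (simp add: \<phi>_def)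
  qed
  have car: "carrier (presented_group S Rel) = word_class S Rel ` words S"
    by (simp add: presented_group_def)
  have "\<phi> \<in> hom (presented_group S Rel) G"
  proof (rule homI)
    show "\<phi> A \<in> carrier G" if "A \<in> carrier (presented_group S Rel)" for A
      using that unfolding car by (auto simp: \<phi> word_eval_closed[OF f])
    show "\<phi> (A \<otimes>\<^bsub>presented_group S Rel\<^esub> B) = \<phi> A \<otimes> \<phi> B"
      if "A \<in> carrier (presented_group S Rel)" "B \<in> carrier (presented_group S Rel)" for A B
      using that unfolding car
      by (auto simp: presented_group_mult \<phi> word_eval_append[OF f])
  qed
  moreover have "\<phi> (word_class S Rel [(g, True)]) = f g" if "g \<in> S" for g
  proof -
    have "[(g, True)] \<in> words S" and "f g \<in> carrier G"
      using that f by (auto simp: words_def)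
    then show ?thesis by (simp add: \<phi>)
  qed
  ultimately show ?thesis by (rule that)
qed

section \<open>The maps \<open>R\<^sub>i\<^sub>j\<close>\<close>

lemma R_at_apply:
  assumes "x \<in> cart_pow X n"
  shows "R_at X R n i j x = x(i := fst (R (x i, x j)), j := snd (R (x i, x j)))"
  using assms by (simp add: R_at_def)

lemma R_at_closed:
  assumes R: "R \<in> X \<times> X \<rightarrow> X \<times> X" and ij: "i \<in> {1..n}" "j \<in> {1..n}"
    and x: "x \<in> cart_pow X n"
  shows "R_at X R n i j x \<in> cart_pow X n"
proof -
  have "(x i, x j) \<in> X \<times> X"
    using x ij by (auto simp: cart_pow_def)
  then have "R (x i, x j) \<in> X \<times> X" using R by blast
  then have "fst (R (x i, x j)) \<in> X" "snd (R (x i, x j)) \<in> X"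
    by (auto simp: mem_Times_iff)
  then show ?thesis
    using x ij unfolding R_at_apply[OF x]
    by (auto simp: cart_pow_def PiE_iff extensional_def)
qed

lemma R_at_left_inverse:
  assumes R: "R \<in> X \<times> X \<rightarrow> X \<times> X" and inverse: "\<And>p. p \<in> X \<times> X \<Longrightarrow> Q (R p) = p"
    and ij: "i \<in> {1..n}" "j \<in> {1..n}" "i \<noteq> j" and x: "x \<in> cart_pow X n"
  shows "R_at X Q n i j (R_at X R n i j x) = x"
proof -
  have "(x i, x j) \<in> X \<times> X"
    using x ij by (auto simp: cart_pow_def)
  then have "Q (R (x i, x j)) = (x i, x j)" by (rule inverse)
  then show ?thesis
    using ij(3) unfolding R_at_apply[OF R_at_closed[OF R ij(1,2) x]]
    by (auto simp: R_at_apply[OF x] fun_eq_iff)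
qed

lemma R_at_Bij:
  assumes bij: "bij_betw R (X \<times> X) (X \<times> X)"
    and ij: "i \<in> {1..n}" "j \<in> {1..n}" "i \<noteq> j"
  shows "R_at X R n i j \<in> Bij (cart_pow X n)"
proof -
  define Q where "Q = inv_into (X \<times> X) R"
  have R: "R \<in> X \<times> X \<rightarrow> X \<times> X"
    using bij by (rule bij_betw_imp_funcset)
  have Q: "Q \<in> X \<times> X \<rightarrow> X \<times> X"
    unfolding Q_def using bij_betw_inv_into[OF bij] by (rule bij_betw_imp_funcset)
  have QR: "Q (R p) = p" if "p \<in> X \<times> X" for p
    unfolding Q_def using bij that by (rule bij_betw_inv_into_left)
  have RQ: "R (Q p) = p" if "p \<in> X \<times> X" for p
    unfolding Q_def using bij that by (rule bij_betw_inv_into_right)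
  have "bij_betw (R_at X R n i j) (cart_pow X n) (cart_pow X n)"
    by (rule bij_betw_byWitness[where f' = "R_at X Q n i j"])
      (use R_at_left_inverse[OF R QR ij] R_at_left_inverse[OF Q RQ ij]
         R_at_closed[OF R ij(1,2)] R_at_closed[OF Q ij(1,2)] in auto)
  then show ?thesis by (simp add: Bij_def R_at_def)
qed

lemma R_at_commute:
  assumes R: "R \<in> X \<times> X \<rightarrow> X \<times> X" and sub: "{i, j, k, l} \<subseteq> {1..n}"
    and dist: "distinct [i, j, k, l]" and x: "x \<in> cart_pow X n"
  shows "R_at X R n i j (R_at X R n k l x) = R_at X R n k l (R_at X R n i j x)"
proof -
  have "R_at X R n i j x \<in> cart_pow X n" "R_at X R n k l x \<in> cart_pow X n"
    using R_at_closed[OF R _ _ x] sub by auto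
  then show ?thesis
    using dist x by (auto simp: R_at_apply fun_eq_iff)
qed

text \<open>For an injection \<open>s\<close> of index sets, pulling points back along \<open>s\<close> is the projection
  \<open>X\<^sup>n \<rightarrow> X\<^sup>m\<close> to the coordinates \<open>s 1, \<dots>, s m\<close>.  Injectivity makes sure that the two updated
  entries of the point are seen by no other coordinates of the projection.\<close>

lemma R_at_reindex:
  assumes s: "inj_on s {1..m}" "s ` {1..m} \<subseteq> {1..n}"
    and ij: "i \<in> {1..m}" "j \<in> {1..m}" and x: "x \<in> cart_pow X n"
  shows "R_at X R m i j (restrict (x \<circ> s) {1..m}) =
    restrict (R_at X R n (s i) (s j) x \<circ> s) {1..m}"
proof -
  have "restrict (x \<circ> s) {1..m} \<in> cart_pow X m"
    using s(2) PiE_mem[OF x[unfolded cart_pow_def]] by (auto simp: cart_pow_def image_subset_iff)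
  then show ?thesis
    using inj_onD[OF s(1)] ij by (auto simp: R_at_apply x fun_eq_iff)
qed

text \<open>Both sides agree on the coordinates \<open>k, i, j\<close>, since their projections to \<open>X\<^sup>3\<close> are the two
  sides of the Yang--Baxter equation at the projection of \<open>x\<close>; on every other coordinate both
  are equal to \<open>x\<close>.\<close>

lemma R_at_yang_baxter:
  assumes yb: "yang_baxter_set X R" and sub: "{i, j, k} \<subseteq> {1..n}"
    and dist: "distinct [i, j, k]" and x: "x \<in> cart_pow X n"
  shows "R_at X R n k i (R_at X R n k j (R_at X R n i j x)) =
    R_at X R n i j (R_at X R n k j (R_at X R n k i x))"
    (is "?L = ?R")
proof -
  have R: "R \<in> X \<times> X \<rightarrow> X \<times> X"
    using yb by (simp add: yang_baxter_set_def)
  have closed: "R_at X R n a b y \<in> cart_pow X n"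
    if "a \<in> {i, j, k}" "b \<in> {i, j, k}" "y \<in> cart_pow X n" for a b y
    using R_at_closed[OF R _ _ that(3)] that(1,2) sub by blast
  define s :: "nat \<Rightarrow> nat" where "s = (\<lambda>m. if m = 1 then k else if m = 2 then i else j)"
  define p where "p y = restrict (y \<circ> s) {1..3}" for y :: "nat \<Rightarrow> 'a"
  have s: "s 1 = k" "s 2 = i" "s 3 = j" by (simp_all add: s_def)
  have three: "{1..3} = {1, 2, 3 :: nat}" by auto
  have inj: "inj_on s {1..3}" using dist by (auto simp: s_def inj_on_def three)
  have range: "s ` {1..3} = {i, j, k}" unfolding three by (auto simp: s_def)
  have p_R_at: "p (R_at X R n (s a) (s b) y) = R_at X R 3 a b (p y)"
    if "a \<in> {1..3}" "b \<in> {1..3}" "y \<in> cart_pow X n" for a b y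
    using R_at_reindex[OF inj _ that] range sub by (simp add: p_def)
  have p12: "p (R_at X R n k i y) = R_at X R 3 1 2 (p y)"
    and p13: "p (R_at X R n k j y) = R_at X R 3 1 3 (p y)"
    and p23: "p (R_at X R n i j y) = R_at X R 3 2 3 (p y)" if "y \<in> cart_pow X n" for y
    using p_R_at[of 1 2 y] p_R_at[of 1 3 y] p_R_at[of 2 3 y] that unfolding s by simp_all
  have "s a \<in> {1..n}" if "a \<in> {1..3}" for a
    using that range sub by blast
  then have "p x \<in> cart_pow X 3"
    using PiE_mem[OF x[unfolded cart_pow_def]] by (auto simp: p_def cart_pow_def)
  then have "R_at X R 3 1 2 (R_at X R 3 1 3 (R_at X R 3 2 3 (p x))) =
      R_at X R 3 2 3 (R_at X R 3 1 3 (R_at X R 3 1 2 (p x)))"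
    using yb by (simp add: yang_baxter_set_def)
  then have p_eq: "p ?L = p ?R"
    using x closed by (simp add: p12 p13 p23)
  show ?thesis
  proof
    fix m
    show "?L m = ?R m"
    proof (cases "m \<in> {i, j, k}")
      case True
      then obtain a where "a \<in> {1..3}" "m = s a" using range by blast
      then show ?thesis using fun_cong[OF p_eq, of a] by (simp add: p_def)
    next
      case False
      then have "R_at X R n a b y m = y m"
        if "a \<in> {i, j, k}" "b \<in> {i, j, k}" "y \<in> cart_pow X n" for a b y
        using that by (auto simp: R_at_apply)
      then show ?thesis using x closed by simp
    qed
  qed
qed

section \<open>The representation of the virtual pure braid group\<close>

theorem proposition3p1:
  fixes X :: "'a set" and R :: "'a \<times> 'a \<Rightarrow> 'a \<times> 'a" and n :: nat
  assumes "yang_baxter_set X R"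
    and "bij_betw R (X \<times> X) (X \<times> X)"
    and "n \<ge> 2"
  shows "\<exists>\<phi>. \<phi> \<in> hom (VP n) (BijGroup (cart_pow X n)) \<and>
    (\<forall>i\<in>{1..n}. \<forall>j\<in>{1..n}. i \<noteq> j \<longrightarrow> \<phi> (vp_gen n i j) = R_at X R n i j)"
proof -
  let ?P = "cart_pow X n"
  let ?G = "BijGroup ?P"
  interpret group ?G by (rule group_BijGroup)
  define f where "f = (\<lambda>(i, j). R_at X R n i j)"
  have R: "R \<in> X \<times> X \<rightarrow> X \<times> X"
    using assms(1) by (simp add: yang_baxter_set_def)
  have carrier: "carrier ?G = Bij ?P"
    by (simp add: BijGroup_def)
  have mult: "g \<otimes>\<^bsub>?G\<^esub> h = compose ?P g h" if "g \<in> Bij ?P" "h \<in> Bij ?P" for g h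
    using that by (simp add: BijGroup_def)
  have f: "f \<in> vp_gens n \<rightarrow> carrier ?G"
    using R_at_Bij[OF assms(2)] by (auto simp: f_def vp_gens_def carrier)
  have rels: "word_eval ?G f u = word_eval ?G f v" if "(u, v) \<in> vp_rels n" for u v
    using that unfolding vp_rels_def
  proof (elim UnE CollectE exE conjE)
    fix i j k l
    assume uv: "(u, v) = ([gen i j, gen k l], [gen k l, gen i j])"
      and sub: "{i, j, k, l} \<subseteq> {1..n}" and dist: "distinct [i, j, k, l]"
    have "R_at X R n i j \<in> Bij ?P" "R_at X R n k l \<in> Bij ?P"
      using R_at_Bij[OF assms(2)] sub dist by auto
    moreover have "compose ?P (R_at X R n i j) (R_at X R n k l) =
        compose ?P (R_at X R n k l) (R_at X R n i j)"
      using R_at_commute[OF R sub dist] by (auto simp: compose_def intro: restrict_ext)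
    ultimately show ?thesis
      using uv by (simp add: f_def carrier mult)
  next
    fix i j k
    assume uv: "(u, v) = ([gen k i, gen k j, gen i j], [gen i j, gen k j, gen k i])"
      and sub: "{i, j, k} \<subseteq> {1..n}" and dist: "distinct [i, j, k]"
    have "R_at X R n k i \<in> Bij ?P" "R_at X R n k j \<in> Bij ?P" "R_at X R n i j \<in> Bij ?P"
      using R_at_Bij[OF assms(2)] sub dist by auto
    moreover have
      "compose ?P (R_at X R n k i) (compose ?P (R_at X R n k j) (R_at X R n i j)) =
       compose ?P (R_at X R n i j) (compose ?P (R_at X R n k j) (R_at X R n k i))"
      using R_at_yang_baxter[OF assms(1) sub dist]
      by (auto simp: compose_def intro: restrict_ext)
    ultimately show ?thesis
      using uv by (simp add: f_def carrier mult compose_Bij)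
  qed
  obtain \<phi> where "\<phi> \<in> hom (presented_group (vp_gens n) (vp_rels n)) ?G"
    and "\<And>g. g \<in> vp_gens n \<Longrightarrow>
      \<phi> (word_class (vp_gens n) (vp_rels n) [(g, True)]) = f g"
    using presented_group_universal[OF f rels] by blast
  then have "\<phi> \<in> hom (VP n) ?G \<and>
      (\<forall>i\<in>{1..n}. \<forall>j\<in>{1..n}. i \<noteq> j \<longrightarrow> \<phi> (vp_gen n i j) = R_at X R n i j)"
    by (auto simp: VP_def vp_gen_def f_def vp_gens_def)
  then show ?thesis by blast
qed

end
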